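(* Let $m,n\ge 2$ and $k\ge1$, and let $\mathcal{F}_1,\dots,\mathcal{F}_k$ be pairwise almost orthogonal symmetric chain decompositions of $Q_m$ and $\mathcal{G}_1,\dots,\mathcal{G}_k$ pairwise almost orthogonal symmetric chain decompositions of $Q_n$. Then there exist $k$ pairwise almost orthogonal symmetric chain decompositions $\mathcal{H}_1,\dots,\mathcal{H}_k$ of $Q_m\times Q_n=Q_{m+n}$ such that for each $i$ every chain of $\mathcal{H}_i$ is contained in a rectangle $A\times C$ with $A\in\mathcal{F}_i$, $C\in\mathcal{G}_i$ (i.e. obtained by decomposing the rectangles of $\mathcal{F}_i\times\mathcal{G}_i$ into symmetric chains), if and only if both collections $\{\mathcal{F}_i\}$ and $\{\mathcal{G}_i\}$ are good.
   Context: $Q_n$ denotes the Boolean lattice of subsets of $[n]=\{1,\dots,n\}$ under inclusion; $Q_m\times Q_n$ (product order) is identified with $Q_{m+n}$. A symmetric chain in $Q_n$ consists of exactly one subset of each size $j,j+1,\dots,n-j$ for some $j$; a symmetric chain decomposition (SCD) is a partition of $Q_n$ into symmetric chains. Two SCDs $\mathcal{F},\mathcal{G}$ of $Q_n$ are almost orthogonal if for all chains $A\in\mathcal{F}$, $B\in\mathcal{G}$, $|A\cap B|\le1$, except when $A$ and $B$ both contain $\varnothing$ and $[n]$, in which case $|A\cap B|=2$. A collection $\{\mathcal{F}^j\}$ of pairwise almost orthogonal SCDs of $Q_n$ is good if either $n$ is even and the $1$-element chains occurring in the different $\mathcal{F}^j$ are pairwise distinct, or $n$ is odd and the graph whose vertex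 set is the union of all $2$-element chains of all $\mathcal{F}^j$ and whose edges are these $2$-element chains admits an orientation in which every vertex has out-degree at most $1$. *)

theory Defs
  imports Main "HOL-Library.Disjoint_Sets"
begin

definition cube :: "nat \<Rightarrow> nat set set" where
  "cube n = Pow {1..n}"

definition symmetric_chain :: "nat \<Rightarrow> nat set set \<Rightarrow> bool" where
  "symmetric_chain n C \<longleftrightarrow>
     C \<subseteq> cube n \<and> chain_subset C \<and> (\<exists>j. 2 * j \<le> n \<and> bij_betw card C {j..n - j})"

definition scd :: "nat \<Rightarrow> nat set set set \<Rightarrow> bool" where
  "scd n F \<longleftrightarrow> partition_on (cube n) F \<and> (\<forall>C\<in>F. symmetric_chain n C)"

definition almost_orthogonal :: "nat \<Rightarrow> nat set set set \<Rightarrow> nat set set set \<Rightarrow> bool" where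
  "almost_orthogonal n F G \<longleftrightarrow>
     (\<forall>A\<in>F. \<forall>B\<in>G.
        if {{}, {1..n}} \<subseteq> A \<and> {{}, {1..n}} \<subseteq> B then card (A \<inter> B) = 2
        else card (A \<inter> B) \<le> 1)"

definition almost_orthogonal_scds :: "nat \<Rightarrow> nat \<Rightarrow> (nat \<Rightarrow> nat set set set) \<Rightarrow> bool" where
  "almost_orthogonal_scds n k F \<longleftrightarrow>
     (\<forall>i\<in>{1..k}. scd n (F i)) \<and>
     pairwise (\<lambda>i j. almost_orthogonal n (F i) (F j)) {1..k}"

text \<open>
  A graph is given by its set of edges, which are two-element vertex sets; its vertices are the
  elements of the edges. An orientation is a set of arcs containing, for every edge
  \<open>{u, v}\<close>, exactly one of the pairs \<open>(u, v)\<close> and \<open>(v, u)\<close>, and no other pairs.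
\<close>

definition orientation :: "'v set set \<Rightarrow> ('v \<times> 'v) set \<Rightarrow> bool" where
  "orientation E D \<longleftrightarrow> bij_betw (\<lambda>(u, v). {u, v}) D E"

definition two_chains :: "nat \<Rightarrow> (nat \<Rightarrow> nat set set set) \<Rightarrow> nat set set set" where
  "two_chains k F = {C. \<exists>i\<in>{1..k}. C \<in> F i \<and> card C = 2}"

text \<open>
  The predicate \<open>good n k F\<close> is meant for families with \<open>almost_orthogonal_scds n k F\<close>. For
  \<open>n \<ge> 2\<close> a two-element chain then lies in only one \<open>F i\<close>, so the graph has no
  parallel edges and its edges may be collected in a set.
\<close>

definition good :: "nat \<Rightarrow> nat \<Rightarrow> (nat \<Rightarrow> nat set set set) \<Rightarrow> bool" where
  "good n k F \<longleftrightarrow>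
     (if even n then disjoint_family_on (\<lambda>i. {C \<in> F i. card C = 1}) {1..k}
      else (\<exists>D. orientation (two_chains k F) D \<and>
              (\<forall>u\<in>\<Union>(two_chains k F). card {v. (u, v) \<in> D} \<le> 1)))"

text \<open>
  The identification of the product of the cubes of dimensions \<open>m\<close> and \<open>n\<close> with the cube of
  dimension \<open>m + n\<close>: the second set is shifted by \<open>m\<close>.
\<close>

definition join_cubes :: "nat \<Rightarrow> nat set \<times> nat set \<Rightarrow> nat set" where
  "join_cubes m = (\<lambda>(X, Y). X \<union> (+) m ` Y)"

lemma join_cubes_subset_iff:
  assumes "X \<in> cube m" "Y \<in> cube n" "X' \<in> cube m" "Y' \<in> cube n"
  shows "join_cubes m (X, Y) \<subseteq> join_cubes m (X', Y') \<longleftrightarrow> X \<subseteq> X' \<and> Y \<subseteq> Y'"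
  using assms unfolding join_cubes_def cube_def by fastforce

lemma bij_betw_join_cubes:
  "bij_betw (join_cubes m) (cube m \<times> cube n) (cube (m + n))"
proof (rule bij_betw_imageI)
  show "inj_on (join_cubes m) (cube m \<times> cube n)"
  proof (rule inj_onI, clarify)
    fix X Y X' Y'
    assume *: "X \<in> cube m" "Y \<in> cube n" "X' \<in> cube m" "Y' \<in> cube n"
      and "join_cubes m (X, Y) = join_cubes m (X', Y')"
    then show "X = X' \<and> Y = Y'"
      using join_cubes_subset_iff[OF *] join_cubes_subset_iff[OF *(3,4,1,2)] by auto
  qed
  show "join_cubes m ` (cube m \<times> cube n) = cube (m + n)"
  proof
    show "join_cubes m ` (cube m \<times> cube n) \<subseteq> cube (m + n)"
      unfolding join_cubes_def cube_def by fastforce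
    show "cube (m + n) \<subseteq> join_cubes m ` (cube m \<times> cube n)"
    proof
      fix Z assume Z: "Z \<in> cube (m + n)"
      define X where "X = Z \<inter> {1..m}"
      define Y where "Y = {y \<in> {1..n}. m + y \<in> Z}"
      have "z \<in> X \<union> (+) m ` Y" if "z \<in> Z" for z
      proof (cases "z \<le> m")
        case True
        then show ?thesis using that Z by (auto simp: X_def cube_def)
      next
        case False
        then have "z = m + (z - m)" "z - m \<in> Y"
          using that Z by (auto simp: Y_def cube_def)
        then show ?thesis by blast
      qed
      moreover have "X \<union> (+) m ` Y \<subseteq> Z"
        by (auto simp: X_def Y_def)
      ultimately have "Z = join_cubes m (X, Y)"
        unfolding join_cubes_def by blast
      moreover have "(X, Y) \<in> cube m \<times> cube n"
        by (auto simp: X_def Y_def cube_def)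
      ultimately show "Z \<in> join_cubes m ` (cube m \<times> cube n)" by blast
    qed
  qed
qed

definition rectangle :: "nat \<Rightarrow> nat set set \<Rightarrow> nat set set \<Rightarrow> nat set set" where
  "rectangle m A C = join_cubes m ` (A \<times> C)"

end

theory Submission
  imports Defs
begin

text \<open>
  A family is good iff one can select an element from each chain with at most two elements so that
  different decompositions select different elements (the tail of the edge, for an orientation).
  In a decomposition of \<open>A \<times> C\<close> with \<open>A\<close> full and \<open>C\<close> short, some chain contains
  \<open>({}, Y)\<close> and \<open>({1..m}, Y)\<close> for some \<open>Y \<in> C\<close>; almost orthogonality forces these \<open>Y\<close> to
  form such a selection. Conversely, given selections, two chains from different decompositions
  can have a bad pair in common only if it has the form \<open>({}, Y)\<close>, \<open>({1..m}, Y)\<close> or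
  \<open>(X, {})\<close>, \<open>(X, {1..n})\<close>, and every rectangle can be decomposed such that these pairs lie in
  a common chain only for the selected element of a short chain.
\<close>

section \<open>Symmetric chains and almost orthogonal decompositions\<close>

lemma symmetric_chainE:
  assumes "symmetric_chain n C"
  obtains j where "2 * j \<le> n" "card ` C = {j..n - j}" "card C = n - 2 * j + 1"
proof -
  obtain j where j: "2 * j \<le> n" "bij_betw card C {j..n - j}"
    using assms by (auto simp: symmetric_chain_def)
  then show thesis
    using that[of j] bij_betw_same_card[OF j(2)] bij_betw_imp_surj_on[OF j(2)] by simp
qed

lemma cube_finite: "X \<in> cube n \<Longrightarrow> finite X"
  unfolding cube_def using finite_subset by blast

lemma finite_cube: "finite (cube n)"
  by (simp add: cube_def)

lemma card_le_cube: "X \<in> cube n \<Longrightarrow> card X \<le> n"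
  unfolding cube_def using card_mono[of "{1..n}" X] by simp

lemma card_eq_cube: "X \<in> cube n \<Longrightarrow> card X = n \<Longrightarrow> X = {1..n}"
  unfolding cube_def using card_subset_eq[of "{1..n}" X] by simp

lemma symmetric_chain_cube: "symmetric_chain n C \<Longrightarrow> X \<in> C \<Longrightarrow> X \<in> cube n"
  by (auto simp: symmetric_chain_def)

lemma symmetric_chain_subset_iff:
  assumes "symmetric_chain n C" "X \<in> C" "Y \<in> C"
  shows "X \<subseteq> Y \<longleftrightarrow> card X \<le> card Y"
proof
  have fin: "finite X" "finite Y"
    using assms cube_finite symmetric_chain_cube by blast+
  then show "X \<subseteq> Y \<Longrightarrow> card X \<le> card Y" by (simp add: card_mono)
  assume "card X \<le> card Y"
  moreover have "X \<subseteq> Y \<or> Y \<subseteq> X"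
    using assms by (auto simp: symmetric_chain_def chain_subset_def)
  ultimately show "X \<subseteq> Y" using fin card_seteq by blast
qed

lemma symmetric_chain_card_inj:
  assumes "symmetric_chain n C" "X \<in> C" "Y \<in> C" "card X = card Y"
  shows "X = Y"
  using symmetric_chain_subset_iff[OF assms(1-3)] symmetric_chain_subset_iff[OF assms(1,3,2)] assms(4)
  by auto

text \<open>The sizes occurring in the chain form an interval \<open>{j..n - j}\<close>, so either
  end of the cube forces \<open>j = 0\<close>, and then every size occurs.\<close>

lemma symmetric_chain_bot_or_top:
  assumes C: "symmetric_chain n C" and "{} \<in> C \<or> {1..n} \<in> C"
  shows "{} \<in> C" "{1..n} \<in> C" "card C = n + 1"
proof -
  obtain j where j: "2 * j \<le> n" "card ` C = {j..n - j}" "card C = n - 2 * j + 1"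
    using symmetric_chainE[OF C] .
  have "0 \<in> card ` C \<or> n \<in> card ` C"
    using assms(2) by (metis card.empty card_atLeastAtMost diff_Suc_1 image_eqI)
  then have "j = 0" using j(1,2) by auto
  then show "card C = n + 1" using j by simp
  have "0 \<in> card ` C" "n \<in> card ` C" using \<open>j = 0\<close> j(2) by auto
  then obtain X Y where "X \<in> C" "card X = 0" "Y \<in> C" "card Y = n" by (metis imageE)
  then show "{} \<in> C" "{1..n} \<in> C"
    using C card_eq_cube cube_finite symmetric_chain_cube by (metis card_0_eq)+
qed

text \<open>The counting of common elements is replaced by a condition on two distinct common
  elements. The hypothesis \<open>n \<ge> 1\<close> keeps \<open>{}\<close> and
  \<open>{1..n}\<close> apart, so that the count 2 in the exceptional case is made up of exactly
  these two sets.\<close>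

lemma almost_orthogonal_iff:
  assumes "n \<ge> 1" "\<And>A. A \<in> F \<Longrightarrow> A \<subseteq> cube n"
  shows "almost_orthogonal n F G \<longleftrightarrow>
    (\<forall>A\<in>F. \<forall>B\<in>G. \<forall>X\<in>A \<inter> B. \<forall>Y\<in>A \<inter> B. X \<noteq> Y \<longrightarrow> {X, Y} = {{}, {1..n}})"
proof -
  have ne: "{} \<noteq> {1..n}" using assms(1) by auto
  have key: "(if {{}, {1..n}} \<subseteq> A \<and> {{}, {1..n}} \<subseteq> B then card (A \<inter> B) = 2 else card (A \<inter> B) \<le> 1)
    \<longleftrightarrow> (\<forall>X\<in>A \<inter> B. \<forall>Y\<in>A \<inter> B. X \<noteq> Y \<longrightarrow> {X, Y} = {{}, {1..n}})" (is "?L \<longleftrightarrow> ?R")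
    if "A \<in> F" for A B
  proof
    have fin: "finite (A \<inter> B)" using assms(2)[OF that] finite_cube finite_subset by blast
    show ?R if L: ?L
    proof (intro ballI impI)
      fix X Y assume XY: "X \<in> A \<inter> B" "Y \<in> A \<inter> B" "X \<noteq> Y"
      have "card {X, Y} \<le> card (A \<inter> B)" using XY fin by (intro card_mono) auto
      then have c: "{{}, {1..n}} \<subseteq> A \<inter> B" "card (A \<inter> B) = 2"
        using L XY(3) by (auto split: if_splits)
      have "{{}, {1..n}} = A \<inter> B" using c fin ne by (intro card_subset_eq) auto
      moreover have "{X, Y} = A \<inter> B" using c fin XY by (intro card_subset_eq) auto
      ultimately show "{X, Y} = {{}, {1..n}}" by simp
    qed
    show ?L if R: ?R
    proof (cases "{{}, {1..n}} \<subseteq> A \<and> {{}, {1..n}} \<subseteq> B")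
      case True
      \<comment> \<open>A common element other than \<open>{}\<close> is paired with
        \<open>{}\<close>, and the condition then makes it the top.\<close>
      have "Z \<in> {{}, {1..n}}" if "Z \<in> A \<inter> B" for Z
      proof (cases "Z = {}")
        case False
        have "{} \<in> A \<inter> B" using True by blast
        from R[rule_format, OF that this False] show ?thesis by blast
      qed simp
      then have "A \<inter> B = {{}, {1..n}}" using True by blast
      then show ?thesis using True ne by simp
    next
      case False
      have "X = Y" if XY: "X \<in> A \<inter> B" "Y \<in> A \<inter> B" for X Y
      proof (rule ccontr)
        assume "X \<noteq> Y"
        then have eq: "{X, Y} = {{}, {1..n}}" by (rule R[rule_format, OF XY])
        have "{X, Y} \<subseteq> A \<inter> B" using XY by simp
        then show False using False unfolding eq by blast
      qed
      then have "card (A \<inter> B) \<le> 1" using fin by (simp add: card_le_Suc0_iff_eq)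
      then show ?thesis using False by (simp only: if_False)
    qed
  qed
  show ?thesis unfolding almost_orthogonal_def by (intro ball_cong refl key)
qed

lemma scd_cube: "scd n F \<Longrightarrow> A \<in> F \<Longrightarrow> A \<subseteq> cube n"
  by (auto simp: scd_def symmetric_chain_def)

lemma scd_unique: "scd n F \<Longrightarrow> A \<in> F \<Longrightarrow> B \<in> F \<Longrightarrow> X \<in> A \<Longrightarrow> X \<in> B \<Longrightarrow> A = B"
  unfolding scd_def partition_on_def disjoint_def by blast

lemma almost_orthogonal_scdsD:
  assumes "almost_orthogonal_scds n k F" "n \<ge> 1" "i \<in> {1..k}" "j \<in> {1..k}" "i \<noteq> j"
    "A \<in> F i" "B \<in> F j" "X \<in> A" "X \<in> B" "Y \<in> A" "Y \<in> B" "X \<noteq> Y"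
  shows "{X, Y} = {{}, {1..n}}"
proof -
  have scd: "scd n (F i)" and ao: "almost_orthogonal n (F i) (F j)"
    using assms(1,3-5) by (auto simp: almost_orthogonal_scds_def pairwise_def)
  show ?thesis
    using almost_orthogonal_iff[THEN iffD1, OF assms(2) scd_cube[OF scd] ao, rule_format, OF _ assms(6,7)]
      assms(8-12) by simp
qed

section \<open>Goodness as a choice of elements from short chains\<close>

text \<open>The bound 2 treats both parities at once: it singles out the one-element chains in even
  dimension and the two-element chains in odd dimension.\<close>

definition short_chain_selector ::
    "nat \<Rightarrow> (nat \<Rightarrow> nat set set set) \<Rightarrow> (nat \<Rightarrow> nat set set \<Rightarrow> nat set) \<Rightarrow> bool" where
  "short_chain_selector k F g \<longleftrightarrow>
     (\<forall>i\<in>{1..k}. \<forall>C\<in>F i. card C \<le> 2 \<longrightarrow> g i C \<in> C) \<and>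
     (\<forall>i\<in>{1..k}. \<forall>j\<in>{1..k}. \<forall>C\<in>F i. \<forall>C'\<in>F j. card C \<le> 2 \<longrightarrow> card C' \<le> 2 \<longrightarrow> i \<noteq> j \<longrightarrow>
        g i C \<noteq> g j C')"

text \<open>For even \<open>n\<close> a short chain is a singleton, so its selected element is
  forced. Distinct selections then mean that no singleton chain occurs in two
  decompositions.\<close>

lemma good_iff_selector_even:
  assumes ao: "almost_orthogonal_scds n k F" and "n \<ge> 2" "even n"
  shows "good n k F \<longleftrightarrow> (\<exists>g. short_chain_selector k F g)"
proof
  have one: "card C = 1" if "i \<in> {1..k}" "C \<in> F i" "card C \<le> 2" for i C
  proof -
    have "symmetric_chain n C" using ao that by (auto simp: almost_orthogonal_scds_def scd_def)
    then obtain j where "2 * j \<le> n" "card C = n - 2 * j + 1" by (rule symmetric_chainE)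
    then have "odd (card C)" using \<open>even n\<close> by simp
    then have "card C \<noteq> 0" "card C \<noteq> 2" by (metis even_zero, metis even_numeral)
    then show ?thesis using that(3) by linarith
  qed
  show "\<exists>g. short_chain_selector k F g" if good: "good n k F"
  proof -
    have d: "disjoint_family_on (\<lambda>i. {C \<in> F i. card C = 1}) {1..k}"
      using good \<open>even n\<close> by (simp add: good_def)
    have "short_chain_selector k F (\<lambda>i. the_elem)"
      unfolding short_chain_selector_def
    proof (intro conjI ballI impI)
      fix i C assume "i \<in> {1..k}" "C \<in> F i" "card C \<le> 2"
      then have "card C = 1" by (rule one)
      then show "the_elem C \<in> C" by (metis card_1_singletonE the_elem_eq insertI1)
    next
      fix i j C C' assume ij: "i \<in> {1..k}" "j \<in> {1..k}" "C \<in> F i" "C' \<in> F j"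
        "card C \<le> 2" "card C' \<le> 2" "i \<noteq> j"
      then have c: "card C = 1" "card C' = 1" using one by blast+
      moreover have "C \<noteq> C'" using disjoint_family_onD[OF d ij(1,2,7)] ij(3,4) c by blast
      ultimately show "the_elem C \<noteq> the_elem C'" by (metis card_1_singletonE the_elem_eq)
    qed
    then show ?thesis by blast
  qed
  show "good n k F" if ex: "\<exists>g. short_chain_selector k F g"
  proof -
    obtain g where g: "short_chain_selector k F g" using ex by blast
    have False if h: "i \<in> {1..k}" "j \<in> {1..k}" "i \<noteq> j" "C \<in> F i" "C \<in> F j" "card C = 1" for i j C
    proof -
      have "card C \<le> 2" using h by simp
      then have "g i C \<in> C" "g j C \<in> C" "g i C \<noteq> g j C"
        using g h unfolding short_chain_selector_def by blast+
      then show False using \<open>card C = 1\<close> by (metis card_1_singletonE singletonD)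
    qed
    then have "disjoint_family_on (\<lambda>i. {C \<in> F i. card C = 1}) {1..k}"
      unfolding disjoint_family_on_def by blast
    then show ?thesis using \<open>even n\<close> by (simp add: good_def)
  qed
qed

text \<open>For odd \<open>n\<close> a short chain is an edge, and selecting an element means
  choosing its tail. Out-degree at most 1 says that distinct edges have distinct tails. Edges within
  one decomposition are disjoint anyway, so the selector has to separate only edges of different
  decompositions.\<close>

lemma good_iff_selector_odd:
  assumes ao: "almost_orthogonal_scds n k F" and "n \<ge> 2" "odd n"
  shows "good n k F \<longleftrightarrow> (\<exists>g. short_chain_selector k F g)"
proof
  have scd: "scd n (F i)" if "i \<in> {1..k}" for i
    using ao that by (auto simp: almost_orthogonal_scds_def)
  have two: "card C = 2" if "i \<in> {1..k}" "C \<in> F i" "card C \<le> 2" for i C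
  proof -
    have "symmetric_chain n C" using scd that by (auto simp: scd_def)
    then obtain j where "2 * j \<le> n" "card C = n - 2 * j + 1" by (rule symmetric_chainE)
    then have "even (card C)" "card C \<noteq> 0" using \<open>odd n\<close> by auto
    then have "card C \<noteq> 1" by (metis odd_one)
    then show ?thesis using that(3) \<open>card C \<noteq> 0\<close> by linarith
  qed
  \<comment> \<open>An edge shared by two decompositions would have to be the pair of
    \<open>{}\<close> and \<open>{1..n}\<close>, but a chain through \<open>{}\<close> has
    \<open>n + 1 > 2\<close> elements. Hence an edge determines its decomposition.\<close>
  have distinct: False
    if h: "i \<in> {1..k}" "j \<in> {1..k}" "i \<noteq> j" "C \<in> F i" "C \<in> F j" "card C = 2" for i j C
  proof -
    obtain X Y where "C = {X, Y}" "X \<noteq> Y" using h(6) by (auto simp: card_2_iff)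
    then have "{} \<in> C" using almost_orthogonal_scdsD[OF ao _ h(1-5), of X Y] \<open>n \<ge> 2\<close> by auto
    moreover have "symmetric_chain n C" using scd h by (auto simp: scd_def)
    ultimately have "card C = n + 1" using symmetric_chain_bot_or_top(3) by blast
    then show False using h \<open>n \<ge> 2\<close> by simp
  qed
  show "\<exists>g. short_chain_selector k F g" if good: "good n k F"
  proof -
    have "\<exists>D. orientation (two_chains k F) D \<and>
        (\<forall>u\<in>\<Union>(two_chains k F). card {v. (u, v) \<in> D} \<le> 1)"
      using good \<open>odd n\<close> by (simp only: good_def if_False)
    then obtain D where "orientation (two_chains k F) D"
      and out: "\<forall>u\<in>\<Union>(two_chains k F). card {v. (u, v) \<in> D} \<le> 1"
      by blast
    then have D: "bij_betw (\<lambda>(u, v). {u, v}) D (two_chains k F)" by (simp add: orientation_def)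
    have "two_chains k F \<subseteq> Pow (cube n)"
      using scd scd_cube by (fastforce simp: two_chains_def)
    then have "finite (two_chains k F)" using finite_cube finite_subset by blast
    then have "finite D" using D bij_betw_finite by blast
    \<comment> \<open>As \<open>card\<close> of an infinite set is 0, the bound on the out-degree is
      informative only together with finiteness.\<close>
    have fin: "finite {v. (u, v) \<in> D}" for u
      by (rule finite_subset[OF _ finite_imageI[OF \<open>finite D\<close>, of snd]]) force
    \<comment> \<open>\<open>e\<close> returns the arc of an edge; its first component, the tail, is
      the selected element.\<close>
    define e where "e = inv_into D (\<lambda>(u, v). {u, v})"
    have e: "e C \<in> D" "C = {fst (e C), snd (e C)}" if "C \<in> two_chains k F" for C
      using that bij_betw_imp_surj_on[OF D] inv_into_into[of C "\<lambda>(u, v). {u, v}" D]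
        f_inv_into_f[of C "\<lambda>(u, v). {u, v}" D] unfolding e_def
      by (simp_all add: case_prod_beta)
    have tc: "C \<in> two_chains k F" if "i \<in> {1..k}" "C \<in> F i" "card C \<le> 2" for i C
      using that two by (auto simp: two_chains_def)
    have "short_chain_selector k F (\<lambda>i C. fst (e C))"
      unfolding short_chain_selector_def
    proof (intro conjI ballI impI)
      fix i C assume "i \<in> {1..k}" "C \<in> F i" "card C \<le> 2"
      then show "fst (e C) \<in> C" using e(2)[OF tc] by blast
    next
      fix i j C C' assume ij: "i \<in> {1..k}" "j \<in> {1..k}" "C \<in> F i" "C' \<in> F j"
        "card C \<le> 2" "card C' \<le> 2" "i \<noteq> j"
      obtain u v where uv: "e C = (u, v)" by force
      obtain u' v' where uv': "e C' = (u', v')" by force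
      have C: "(u, v) \<in> D" "C = {u, v}" "(u', v') \<in> D" "C' = {u', v'}"
        using e(1)[OF tc] e(2)[OF tc[OF ij(1,3,5)]] e(2)[OF tc[OF ij(2,4,6)]] ij uv uv'
        by (metis, simp, metis, simp)
      show "fst (e C) \<noteq> fst (e C')"
      proof
        assume "fst (e C) = fst (e C')"
        \<comment> \<open>Both arcs leave \<open>u\<close>, so they coincide and the two edges are
          the same chain, which \<open>distinct\<close> forbids.\<close>
        then have "u' = u" using uv uv' by simp
        moreover have "card {w. (u, w) \<in> D} \<le> 1" using out tc ij C by blast
        ultimately have "v = v'" using C fin[of u]
          by (simp add: card_le_Suc0_iff_eq)
        then have "C = C'" using C \<open>u' = u\<close> by simp
        then show False using distinct ij two by blast
      qed
    qed
    then show ?thesis by blast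
  qed
  show "good n k F" if ex: "\<exists>g. short_chain_selector k F g"
  proof -
    obtain g where g: "short_chain_selector k F g" using ex by blast
    define D where "D = {(g i C, v) | i C v. i \<in> {1..k} \<and> C \<in> F i \<and> card C = 2 \<and> C = {g i C, v}}"
    have DE: "\<exists>i\<in>{1..k}. {u, v} \<in> F i \<and> card {u, v} = 2 \<and> g i {u, v} = u" if "(u, v) \<in> D" for u v
      using that by (auto simp: D_def)
    have "orientation (two_chains k F) D"
      unfolding orientation_def
    proof (rule bij_betw_imageI)
      show "inj_on (\<lambda>(u, v). {u, v}) D"
      proof (rule inj_onI, clarify)
        fix u v u' v'
        assume h: "(u, v) \<in> D" "(u', v') \<in> D" and eq: "{u, v} = {u', v'}"
        obtain i where i: "i \<in> {1..k}" "{u, v} \<in> F i" "card {u, v} = 2" "g i {u, v} = u"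
          using DE[OF h(1)] by blast
        obtain j where j: "j \<in> {1..k}" "{u, v} \<in> F j" "g j {u, v} = u'"
          using DE[OF h(2)] eq by metis
        have "i = j" using distinct i j by blast
        then have "u = u'" using i j by simp
        then show "u = u' \<and> v = v'" using eq by (metis doubleton_eq_iff)
      qed
      show "(\<lambda>(u, v). {u, v}) ` D = two_chains k F"
      proof
        show "(\<lambda>(u, v). {u, v}) ` D \<subseteq> two_chains k F"
          using DE by (force simp: two_chains_def)
        show "two_chains k F \<subseteq> (\<lambda>(u, v). {u, v}) ` D"
        proof
          fix C assume "C \<in> two_chains k F"
          then obtain i where i: "i \<in> {1..k}" "C \<in> F i" "card C = 2" by (auto simp: two_chains_def)
          then have "g i C \<in> C" using g by (auto simp: short_chain_selector_def)
          then obtain v where v: "C = {g i C, v}" using i(3) by (auto simp: card_2_iff)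
          then have "(g i C, v) \<in> D" using i by (auto simp: D_def)
          then show "C \<in> (\<lambda>(u, v). {u, v}) ` D" using v by (intro image_eqI) auto
        qed
      qed
    qed
    moreover have "card {v. (u, v) \<in> D} \<le> 1" for u
    proof -
      have "v = v'" if h: "(u, v) \<in> D" "(u, v') \<in> D" for v v'
      proof -
        obtain i where i: "i \<in> {1..k}" "{u, v} \<in> F i" "card {u, v} = 2" "g i {u, v} = u"
          using DE[OF h(1)] by blast
        obtain j where j: "j \<in> {1..k}" "{u, v'} \<in> F j" "card {u, v'} = 2" "g j {u, v'} = u"
          using DE[OF h(2)] by blast
        \<comment> \<open>Tails from different decompositions differ, so both arcs come from one
          decomposition, where chains meeting in \<open>u\<close> are equal.\<close>
        have "i = j" using g i j unfolding short_chain_selector_def by (metis order_refl)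
        then have "{u, v} = {u, v'}" using scd_unique[OF scd, of i "{u, v}" "{u, v'}" u] i j by blast
        then show "v = v'" by (metis doubleton_eq_iff)
      qed
      then show ?thesis
        by (cases "finite {v. (u, v) \<in> D}") (auto simp: card_le_Suc0_iff_eq)
    qed
    ultimately show ?thesis using \<open>odd n\<close> by (auto simp: good_def)
  qed
qed

lemma good_iff_selector:
  assumes "almost_orthogonal_scds n k F" "n \<ge> 2"
  shows "good n k F \<longleftrightarrow> (\<exists>g. short_chain_selector k F g)"
  using assms good_iff_selector_even good_iff_selector_odd by blast

section \<open>Symmetric chains of pairs in the product of two cubes\<close>

text \<open>Symmetric chains of the joined cube, seen as sets of pairs. Surjectivity of the rank
  onto an interval suffices in place of a bijection, since comparable pairs of equal rank
  coincide.\<close>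

definition product_symmetric_chain :: "nat \<Rightarrow> nat \<Rightarrow> (nat set \<times> nat set) set \<Rightarrow> bool" where
  "product_symmetric_chain m n D \<longleftrightarrow>
     D \<subseteq> cube m \<times> cube n \<and>
     (\<forall>P\<in>D. \<forall>Q\<in>D. fst P \<subseteq> fst Q \<and> snd P \<subseteq> snd Q \<or> fst Q \<subseteq> fst P \<and> snd Q \<subseteq> snd P) \<and>
     (\<exists>j. 2 * j \<le> m + n \<and> (\<lambda>P. card (fst P) + card (snd P)) ` D = {j..m + n - j})"

lemma card_join_cubes:
  assumes "X \<in> cube m" "Y \<in> cube n"
  shows "card (join_cubes m (X, Y)) = card X + card Y"
proof -
  have "X \<inter> (+) m ` Y = {}" using assms by (fastforce simp: cube_def)
  moreover have "card ((+) m ` Y) = card Y" by (intro card_image) auto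
  ultimately show ?thesis
    unfolding join_cubes_def using assms cube_finite by (auto simp: card_Un_disjoint)
qed

lemma symmetric_chain_join_iff:
  assumes D: "D \<subseteq> cube m \<times> cube n"
  shows "symmetric_chain (m + n) (join_cubes m ` D) \<longleftrightarrow> product_symmetric_chain m n D"
proof -
  have sub: "join_cubes m ` D \<subseteq> cube (m + n)"
    using D bij_betw_imp_surj_on[OF bij_betw_join_cubes[of m n]] by blast
  have "(join_cubes m P \<subseteq> join_cubes m Q \<longleftrightarrow> fst P \<subseteq> fst Q \<and> snd P \<subseteq> snd Q)"
    if "P \<in> D" "Q \<in> D" for P Q
    using that D join_cubes_subset_iff[of "fst P" m "snd P" n "fst Q" "snd Q"]
    by (cases P; cases Q) auto
  then have chain: "chain_subset (join_cubes m ` D) \<longleftrightarrow>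
      (\<forall>P\<in>D. \<forall>Q\<in>D. fst P \<subseteq> fst Q \<and> snd P \<subseteq> snd Q \<or> fst Q \<subseteq> fst P \<and> snd Q \<subseteq> snd P)"
    unfolding chain_subset_def by simp
  have im: "card ` join_cubes m ` D = (\<lambda>P. card (fst P) + card (snd P)) ` D"
    unfolding image_image using D by (intro image_cong) (auto simp: card_join_cubes)
  have inj: "inj_on card (join_cubes m ` D)" if "chain_subset (join_cubes m ` D)"
  proof (rule inj_onI)
    fix Z W assume h: "Z \<in> join_cubes m ` D" "W \<in> join_cubes m ` D" "card Z = card W"
    then have "finite Z" "finite W" "Z \<subseteq> W \<or> W \<subseteq> Z"
      using sub cube_finite that unfolding chain_subset_def by blast+
    then show "Z = W" using h(3) by (auto dest: card_subset_eq)
  qed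
  show ?thesis
    unfolding symmetric_chain_def product_symmetric_chain_def chain[symmetric]
    using sub D inj im by (auto simp: bij_betw_def)
qed

text \<open>The required families \<open>H\<close> in pair coordinates; almost orthogonality has the
  form given by \<open>almost_orthogonal_iff\<close>.\<close>

definition product_decompositions ::
  "nat \<Rightarrow> nat \<Rightarrow> nat \<Rightarrow> (nat \<Rightarrow> nat set set set) \<Rightarrow> (nat \<Rightarrow> nat set set set) \<Rightarrow>
     (nat \<Rightarrow> (nat set \<times> nat set) set set) \<Rightarrow> bool" where
  "product_decompositions m n k F G K \<longleftrightarrow>
     (\<forall>i\<in>{1..k}. partition_on (cube m \<times> cube n) (K i) \<and>
        (\<forall>D\<in>K i. product_symmetric_chain m n D \<and> (\<exists>A\<in>F i. \<exists>C\<in>G i. D \<subseteq> A \<times> C))) \<and>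
     (\<forall>i\<in>{1..k}. \<forall>j\<in>{1..k}. i \<noteq> j \<longrightarrow> (\<forall>D\<in>K i. \<forall>E\<in>K j. \<forall>P\<in>D \<inter> E. \<forall>Q\<in>D \<inter> E. P \<noteq> Q \<longrightarrow>
        {P, Q} = {({}, {}), ({1..m}, {1..n})}))"

lemma product_symmetric_chain_swap:
  assumes "product_symmetric_chain m n D"
  shows "product_symmetric_chain n m (prod.swap ` D)"
proof -
  have "(\<lambda>P. card (fst P) + card (snd P)) ` prod.swap ` D = (\<lambda>P. card (fst P) + card (snd P)) ` D"
    unfolding image_image by (simp add: add.commute)
  moreover have "prod.swap ` D \<subseteq> cube n \<times> cube m"
    using assms by (auto simp: product_symmetric_chain_def)
  moreover have "\<forall>P\<in>prod.swap ` D. \<forall>Q\<in>prod.swap ` D.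
      fst P \<subseteq> fst Q \<and> snd P \<subseteq> snd Q \<or> fst Q \<subseteq> fst P \<and> snd Q \<subseteq> snd P"
    using assms unfolding product_symmetric_chain_def by simp blast
  ultimately show ?thesis
    using assms unfolding product_symmetric_chain_def by (simp add: add.commute)
qed

lemma partition_on_image:
  assumes "partition_on S P" "inj_on f S"
  shows "partition_on (f ` S) ((`) f ` P)"
proof (rule partition_onI)
  show "\<Union> ((`) f ` P) = f ` S" using partition_onD1[OF assms(1)] by blast
  show "{} \<notin> (`) f ` P" using partition_onD3[OF assms(1)] by auto
  show "disjnt p q" if pq: "p \<in> (`) f ` P" "q \<in> (`) f ` P" "p \<noteq> q" for p q
  proof -
    obtain a b where ab: "a \<in> P" "b \<in> P" "p = f ` a" "q = f ` b" using pq by auto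
    then have "a \<inter> b = {}" using pq(3) partition_onD2[OF assms(1)] by (auto simp: disjoint_def)
    moreover have "a \<subseteq> S" "b \<subseteq> S" using ab partition_onD1[OF assms(1)] by auto
    ultimately show ?thesis
      using inj_on_image_Int[OF assms(2)] ab by (metis disjnt_def image_empty)
  qed
qed

text \<open>By this symmetry of the two factors, the necessity of goodness has to be argued for the
  second family only.\<close>

lemma product_decompositions_swap:
  assumes K: "product_decompositions m n k F G K"
  shows "product_decompositions n m k G F (\<lambda>i. (`) prod.swap ` K i)"
  unfolding product_decompositions_def
proof (intro conjI ballI impI)
  fix i assume i: "i \<in> {1..k}"
  have "partition_on (prod.swap ` (cube m \<times> cube n)) ((`) prod.swap ` K i)"
    using K i by (intro partition_on_image) (auto simp: product_decompositions_def)
  then show "partition_on (cube n \<times> cube m) ((`) prod.swap ` K i)"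
    by (simp add: product_swap)
  fix D' assume "D' \<in> (`) prod.swap ` K i"
  then obtain D where D: "D \<in> K i" "D' = prod.swap ` D" by auto
  then show "product_symmetric_chain n m D'"
    using K i product_symmetric_chain_swap by (auto simp: product_decompositions_def)
  obtain A C where AC: "A \<in> F i" "C \<in> G i" "D \<subseteq> A \<times> C"
    using K i D(1) unfolding product_decompositions_def by meson
  then have "D' \<subseteq> C \<times> A" using D by auto
  then show "\<exists>A\<in>G i. \<exists>C\<in>F i. D' \<subseteq> A \<times> C" using AC by blast
next
  fix i j D' E' P' Q'
  assume h: "i \<in> {1..k}" "j \<in> {1..k}" "i \<noteq> j" "D' \<in> (`) prod.swap ` K i" "E' \<in> (`) prod.swap ` K j"
    "P' \<in> D' \<inter> E'" "Q' \<in> D' \<inter> E'" "P' \<noteq> Q'"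
  obtain D E where DE: "D \<in> K i" "D' = prod.swap ` D" "E \<in> K j" "E' = prod.swap ` E"
    using h by auto
  have P': "prod.swap P' \<in> D \<inter> E" and Q': "prod.swap Q' \<in> D \<inter> E"
    and ne: "prod.swap P' \<noteq> prod.swap Q'"
    using h DE by auto
  have "{prod.swap P', prod.swap Q'} = {({}, {}), ({1..m}, {1..n})}"
    by (rule K[unfolded product_decompositions_def, THEN conjunct2, rule_format, OF h(1-3) DE(1,3) P' Q' ne])
  then have "prod.swap ` {prod.swap P', prod.swap Q'} = prod.swap ` {({}, {}), ({1..m}, {1..n})}"
    by (rule arg_cong)
  then show "{P', Q'} = {({}, {}), ({1..n}, {1..m})}" by simp
qed

lemma join_cubes_inj:
  assumes "P \<in> cube m \<times> cube n" "Q \<in> cube m \<times> cube n" "join_cubes m P = join_cubes m Q"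
  shows "P = Q"
  using inj_onD[OF bij_betw_imp_inj_on[OF bij_betw_join_cubes[of m n]]] assms by blast

lemma join_cubes_bot: "join_cubes m ({}, {}) = {}"
  by (simp add: join_cubes_def)

lemma join_cubes_top: "join_cubes m ({1..m}, {1..n}) = {1..m + n}"
  by (auto simp: join_cubes_def image_add_atLeastAtMost)

text \<open>Both directions transport along the bijection \<open>join_cubes m\<close>, which
  preserves order and rank and sends the bottom and top pairs to \<open>{}\<close> and
  \<open>{1..m + n}\<close>. All further work can thus be done with pairs.\<close>

lemma decompositions_iff_product_decompositions:
  assumes mn: "m + n \<ge> 1" and F: "\<And>i. i \<in> {1..k} \<Longrightarrow> scd m (F i)"
    and G: "\<And>i. i \<in> {1..k} \<Longrightarrow> scd n (G i)"
  shows "(\<exists>H. almost_orthogonal_scds (m + n) k H \<and>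
            (\<forall>i\<in>{1..k}. \<forall>D\<in>H i. \<exists>A\<in>F i. \<exists>C\<in>G i. D \<subseteq> rectangle m A C))
         \<longleftrightarrow> (\<exists>K. product_decompositions m n k F G K)" (is "?L \<longleftrightarrow> ?R")
proof
  let ?J = "join_cubes m"
  let ?S = "cube m \<times> cube n"
  have bij: "bij_betw ?J ?S (cube (m + n))" by (rule bij_betw_join_cubes)
  note inj = bij_betw_imp_inj_on[OF bij] and surj = bij_betw_imp_surj_on[OF bij]
  have ends: "({}, {}) \<in> ?S" "({1..m}, {1..n}) \<in> ?S" by (auto simp: cube_def)
  have pairs: "{P, Q} = {({}, {}), ({1..m}, {1..n})} \<longleftrightarrow> {?J P, ?J Q} = {{}, {1..m + n}}"
    if "P \<in> ?S" "Q \<in> ?S" for P Q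
  proof -
    have "?J ` {P, Q} = ?J ` {({}, {}), ({1..m}, {1..n})} \<longleftrightarrow> {P, Q} = {({}, {}), ({1..m}, {1..n})}"
      using that ends by (intro inj_on_image_eq_iff[OF inj]) auto
    then show ?thesis by (simp only: image_insert image_empty join_cubes_bot join_cubes_top)
  qed
  show ?R if ?L
  proof -
    obtain H where H: "almost_orthogonal_scds (m + n) k H"
      and HFG: "\<And>i D. i \<in> {1..k} \<Longrightarrow> D \<in> H i \<Longrightarrow> \<exists>A\<in>F i. \<exists>C\<in>G i. D \<subseteq> rectangle m A C"
      using \<open>?L\<close> by blast
    have Hi: "scd (m + n) (H i)" if "i \<in> {1..k}" for i
      using H that by (auto simp: almost_orthogonal_scds_def)
    define I where "I = inv_into ?S ?J"
    define K where "K = (\<lambda>i. (`) I ` H i)"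
    have I: "I Z \<in> ?S" "?J (I Z) = Z" if "Z \<in> cube (m + n)" for Z
      using that surj by (auto simp: I_def inv_into_into f_inv_into_f)
    have IJ: "I (?J P) = P" if "P \<in> ?S" for P
      using that inj by (simp add: I_def)
    have JI: "?J ` I ` D = D" if "D \<subseteq> cube (m + n)" for D
      using that I unfolding image_image by force
    have "product_decompositions m n k F G K"
      unfolding product_decompositions_def
    proof (intro conjI ballI impI)
      fix i assume i: "i \<in> {1..k}"
      have "bij_betw I (cube (m + n)) ?S" unfolding I_def by (rule bij_betw_inv_into[OF bij])
      then show "partition_on ?S (K i)"
        using partition_on_image[of "cube (m + n)" "H i" I] Hi[OF i]
        by (simp add: K_def scd_def bij_betw_def)
      fix D' assume "D' \<in> K i"
      then obtain D where D: "D \<in> H i" "D' = I ` D" by (auto simp: K_def)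
      have Dc: "D \<subseteq> cube (m + n)" using scd_cube[OF Hi[OF i] D(1)] .
      have D'S: "D' \<subseteq> ?S" using D(2) Dc I(1) by blast
      show "product_symmetric_chain m n D'"
        using symmetric_chain_join_iff[OF D'S] JI[OF Dc] D Hi[OF i] by (simp add: scd_def)
      obtain A C where AC: "A \<in> F i" "C \<in> G i" "D \<subseteq> rectangle m A C" using HFG[OF i D(1)] by blast
      have "A \<times> C \<subseteq> ?S" using scd_cube[OF F[OF i] AC(1)] scd_cube[OF G[OF i] AC(2)] by blast
      then have "I ` rectangle m A C \<subseteq> A \<times> C"
        using IJ unfolding rectangle_def by fastforce
      then show "\<exists>A\<in>F i. \<exists>C\<in>G i. D' \<subseteq> A \<times> C" using AC D by blast
    next
      fix i j D' E' P Q
      assume h: "i \<in> {1..k}" "j \<in> {1..k}" "i \<noteq> j" "D' \<in> K i" "E' \<in> K j"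
        "P \<in> D' \<inter> E'" "Q \<in> D' \<inter> E'" "P \<noteq> Q"
      obtain D E where DE: "D \<in> H i" "D' = I ` D" "E \<in> H j" "E' = I ` E"
        using h by (auto simp: K_def)
      have c: "D \<subseteq> cube (m + n)" "E \<subseteq> cube (m + n)" using DE Hi h scd_cube by blast+
      then have PQ: "P \<in> ?S" "Q \<in> ?S" using h DE I by auto
      have "?J P \<in> D" "?J P \<in> E" "?J Q \<in> D" "?J Q \<in> E" using h DE JI c by auto
      moreover have "?J P \<noteq> ?J Q" using PQ h(8) join_cubes_inj by metis
      ultimately have "{?J P, ?J Q} = {{}, {1..m + n}}"
        by (rule almost_orthogonal_scdsD[OF H mn h(1-3) DE(1,3)])
      then show "{P, Q} = {({}, {}), ({1..m}, {1..n})}" using pairs[OF PQ] by simp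
    qed
    then show ?thesis by blast
  qed
  show ?L if R: ?R
  proof -
    obtain K where K: "product_decompositions m n k F G K" using R by blast
    define H where "H = (\<lambda>i. (`) ?J ` K i)"
    have KS: "D \<subseteq> ?S" if "i \<in> {1..k}" "D \<in> K i" for i D
      using K that by (auto simp: product_decompositions_def product_symmetric_chain_def)
    have Hi: "scd (m + n) (H i)" if i: "i \<in> {1..k}" for i
      unfolding scd_def
    proof
      show "partition_on (cube (m + n)) (H i)"
        using partition_on_image[OF _ inj, of "K i"] K i
        by (simp add: product_decompositions_def H_def surj)
      show "\<forall>C\<in>H i. symmetric_chain (m + n) C"
        using symmetric_chain_join_iff KS K i by (auto simp: product_decompositions_def H_def)
    qed
    have "almost_orthogonal (m + n) (H i) (H j)" if ij: "i \<in> {1..k}" "j \<in> {1..k}" "i \<noteq> j" for i j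
    proof (subst almost_orthogonal_iff[OF mn])
      show "A \<in> H i \<Longrightarrow> A \<subseteq> cube (m + n)" for A using Hi[OF ij(1)] scd_cube by blast
      show "\<forall>A\<in>H i. \<forall>B\<in>H j. \<forall>X\<in>A \<inter> B. \<forall>Y\<in>A \<inter> B. X \<noteq> Y \<longrightarrow> {X, Y} = {{}, {1..m + n}}"
      proof (intro ballI impI)
        fix A B X Y assume h: "A \<in> H i" "B \<in> H j" "X \<in> A \<inter> B" "Y \<in> A \<inter> B" "X \<noteq> Y"
        obtain D E where DE: "D \<in> K i" "A = ?J ` D" "E \<in> K j" "B = ?J ` E"
          using h by (auto simp: H_def)
        have S: "D \<subseteq> ?S" "E \<subseteq> ?S" using DE KS ij by auto
        have AB: "A \<inter> B = ?J ` (D \<inter> E)"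
          using inj_on_image_Int[OF inj S] DE by simp
        obtain P Q where PQ: "P \<in> D \<inter> E" "Q \<in> D \<inter> E" "X = ?J P" "Y = ?J Q"
          using h AB by auto
        then have "{P, Q} = {({}, {}), ({1..m}, {1..n})}"
          using h(5) by (intro K[unfolded product_decompositions_def, THEN conjunct2, rule_format,
                OF ij DE(1,3)]) auto
        moreover have "P \<in> ?S" "Q \<in> ?S" using PQ(1,2) S by blast+
        ultimately show "{X, Y} = {{}, {1..m + n}}" unfolding PQ(3,4) by (intro pairs[THEN iffD1])
      qed
    qed
    then have "almost_orthogonal_scds (m + n) k H"
      using Hi by (auto simp: almost_orthogonal_scds_def pairwise_def)
    moreover have "\<exists>A\<in>F i. \<exists>C\<in>G i. D \<subseteq> rectangle m A C" if h: "i \<in> {1..k}" "D \<in> H i" for i D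
    proof -
      obtain D' where D': "D' \<in> K i" "D = ?J ` D'" using h by (auto simp: H_def)
      then obtain A C where "A \<in> F i" "C \<in> G i" "D' \<subseteq> A \<times> C"
        using K h(1) unfolding product_decompositions_def by meson
      then show ?thesis using D' unfolding rectangle_def by (meson image_mono)
    qed
    ultimately show ?thesis by blast
  qed
qed

section \<open>Necessity of goodness\<close>

text \<open>The ranks of a symmetric chain form an interval invariant under reflection, so one
  element forces all ranks between its own and the mirror image of it.\<close>

lemma product_symmetric_chain_level:
  assumes D: "product_symmetric_chain m n D" and P: "(X, Y) \<in> D"
    and r: "card X + card Y \<le> r" "r \<le> m + n - (card X + card Y)"
  shows "\<exists>X' Y'. (X', Y') \<in> D \<and> card X' + card Y' = r"
proof -
  obtain j where j: "(\<lambda>P. card (fst P) + card (snd P)) ` D = {j..m + n - j}"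
    using D by (auto simp: product_symmetric_chain_def)
  have "card X + card Y \<in> {j..m + n - j}" using j P by force
  then have "r \<in> (\<lambda>P. card (fst P) + card (snd P)) ` D" unfolding j using r by auto
  then obtain P' where "P' \<in> D" "r = card (fst P') + card (snd P')" by (rule imageE)
  then show ?thesis by (intro exI[of _ "fst P'"] exI[of _ "snd P'"]) simp
qed

lemma product_symmetric_chain_comparable:
  assumes "product_symmetric_chain m n D" "(X, Y) \<in> D" "(X', Y') \<in> D"
  shows "X \<subseteq> X' \<and> Y \<subseteq> Y' \<or> X' \<subseteq> X \<and> Y' \<subseteq> Y"
proof -
  have "\<forall>P\<in>D. \<forall>Q\<in>D. fst P \<subseteq> fst Q \<and> snd P \<subseteq> snd Q \<or> fst Q \<subseteq> fst P \<and> snd Q \<subseteq> snd P"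
    using assms(1) by (simp add: product_symmetric_chain_def)
  from this[rule_format, OF assms(2,3)] show ?thesis by simp
qed

text \<open>
  For a two-element chain with bottom \<open>Y\<^sub>0\<close> and top \<open>Y\<^sub>1\<close>, the decomposition of the rectangle
  consists of a chain from \<open>({}, Y\<^sub>0)\<close> to the full set and \<open>Y\<^sub>1\<close>, and at most one other chain;
  the column where the second chain does not live is traversed completely by the first one.
\<close>

lemma short_chain_traversed:
  assumes K: "product_decompositions m n k F G K" and i: "i \<in> {1..k}"
    and F: "scd m (F i)" and G: "scd n (G i)" and "m \<ge> 1" and C: "C \<in> G i" "card C \<le> 2"
  shows "\<exists>Y\<in>C. \<exists>D\<in>K i. ({}, Y) \<in> D \<and> ({1..m}, Y) \<in> D"
proof -
  have sC: "symmetric_chain n C" using G C by (auto simp: scd_def)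
  obtain j where j: "2 * j \<le> n" "card ` C = {j..n - j}" "card C = n - 2 * j + 1"
    using symmetric_chainE[OF sC] .
  \<comment> \<open>\<open>A\<close> is the full chain of \<open>F i\<close>; the argument takes
    place in the rectangle of \<open>A\<close> and \<open>C\<close>.\<close>
  have "{} \<in> \<Union> (F i)" using F by (auto simp: scd_def partition_on_def cube_def)
  then obtain A where A: "A \<in> F i" "{} \<in> A" by blast
  have sA: "symmetric_chain m A" using F A by (auto simp: scd_def)
  have Am: "{1..m} \<in> A" using symmetric_chain_bot_or_top[OF sA] A by blast
  \<comment> \<open>\<open>Y0\<close> and \<open>Y1\<close> are the bottom and the top of
    \<open>C\<close>, equal if \<open>C\<close> is a singleton.\<close>
  have "j \<in> card ` C" "n - j \<in> card ` C" using j by auto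
  then obtain Y0 Y1 where Y0: "Y0 \<in> C" "card Y0 = j" and Y1: "Y1 \<in> C" "card Y1 = n - j"
    by (metis imageE)
  have lev: "j \<le> card Y" "card Y \<le> n - j" if "Y \<in> C" for Y
    using that j(2) by force+
  have levA: "card X \<le> m" if "X \<in> A" for X using that sA symmetric_chain_cube card_le_cube by blast
  have part: "partition_on (cube m \<times> cube n) (K i)"
    and psc: "\<And>D. D \<in> K i \<Longrightarrow> product_symmetric_chain m n D"
    and sub: "\<And>D. D \<in> K i \<Longrightarrow> \<exists>A\<in>F i. \<exists>C\<in>G i. D \<subseteq> A \<times> C"
    using K i unfolding product_decompositions_def by blast+
  have cover: "\<exists>D\<in>K i. ({}, Y) \<in> D" if "Y \<in> C" for Y
  proof -
    have "({}, Y) \<in> cube m \<times> cube n"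
      using that symmetric_chain_cube[OF sC] by (auto simp: cube_def)
    then show ?thesis using partition_onD1[OF part] by blast
  qed
  \<comment> \<open>A chain lies in a single rectangle, and \<open>({}, Y)\<close> determines which
    one.\<close>
  have inAC: "D \<subseteq> A \<times> C" if D: "D \<in> K i" "({}, Y) \<in> D" "Y \<in> C" for D Y
  proof -
    obtain A' C' where AC: "A' \<in> F i" "C' \<in> G i" "D \<subseteq> A' \<times> C'" using sub[OF D(1)] by blast
    then have "{} \<in> A'" "Y \<in> C'" using D(2) by auto
    then have "A' = A" "C' = C"
      using scd_unique[OF F AC(1) A(1) _ A(2)] scd_unique[OF G AC(2) C(1) _ D(3)] by auto
    then show ?thesis using AC by simp
  qed
  obtain D where D: "D \<in> K i" "({}, Y0) \<in> D" using cover[OF Y0(1)] by blast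
  note DAC = inAC[OF D Y0(1)]
  \<comment> \<open>\<open>D\<close> contains rank \<open>j\<close>, so by symmetry it reaches rank
    \<open>m + n - j\<close>, and the only pair of that rank in the rectangle is
    \<open>({1..m}, Y1)\<close>.\<close>
  have "\<exists>X Y. (X, Y) \<in> D \<and> card X + card Y = m + n - j"
    by (rule product_symmetric_chain_level[OF psc[OF D(1)] D(2)]) (use Y0 j(1) in auto)
  then obtain X Y where XY: "(X, Y) \<in> D" "card X + card Y = m + n - j" by blast
  have XYAC: "X \<in> A" "Y \<in> C" using XY DAC by auto
  then have "card X \<le> m" "card Y \<le> n - j" using lev levA by auto
  then have "card X = m" "card Y = card Y1" using XY(2) Y1(2) j(1) by linarith+
  then have "X = {1..m}" "Y = Y1"
    using card_eq_cube symmetric_chain_cube[OF sA XYAC(1)] symmetric_chain_card_inj[OF sC XYAC(2) Y1(1)]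
    by auto
  then have top: "({1..m}, Y1) \<in> D" using XY by simp
  \<comment> \<open>If the chain \<open>E\<close> through \<open>({}, Y1)\<close> is
    \<open>D\<close> itself, then \<open>Y1\<close> is traversed. Otherwise \<open>E\<close> and
    \<open>D\<close> are disjoint, and this forces \<open>D\<close> to traverse
    \<open>Y0\<close>.\<close>
  obtain E where E: "E \<in> K i" "({}, Y1) \<in> E" using cover[OF Y1(1)] by blast
  note EAC = inAC[OF E Y1(1)]
  show ?thesis
  proof (cases "E = D")
    case True
    then show ?thesis using E top Y1(1) by blast
  next
    case False
    have disj: "P \<notin> D" if "P \<in> E" for P
      using that False E(1) D(1) partition_onD2[OF part] unfolding disjoint_def by blast
    have "Y0 \<noteq> Y1" using disj[OF E(2)] D(2) by blast
    then have "n - j \<noteq> j" using symmetric_chain_card_inj[OF sC Y0(1) Y1(1)] Y0 Y1 by auto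
    then have n: "n = 2 * j + 1" using j C(2) by simp
    have YC: "Y = Y0 \<and> card Y = j \<or> Y = Y1 \<and> card Y = j + 1" if "Y \<in> C" for Y
    proof -
      have "card Y = j \<or> card Y = j + 1" using lev[OF that] n by auto
      then show ?thesis
        using symmetric_chain_card_inj[OF sC that Y0(1)] symmetric_chain_card_inj[OF sC that Y1(1)] Y0 Y1 n
        by auto
    qed
    \<comment> \<open>\<open>E\<close> contains rank \<open>j + 1\<close> and hence rank
      \<open>m + j\<close>. The candidates in the rectangle are \<open>({1..m}, Y0)\<close>, which
      is incomparable to \<open>({}, Y1)\<close>, and a pair with second component
      \<open>Y1\<close>; so \<open>E\<close> takes the latter.\<close>
    have "\<exists>X Y. (X, Y) \<in> E \<and> card X + card Y = m + j"
      by (rule product_symmetric_chain_level[OF psc[OF E(1)] E(2)]) (use Y1 n \<open>m \<ge> 1\<close> in auto)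
    then obtain X Y where XY: "(X, Y) \<in> E" "card X + card Y = m + j" by blast
    have XYAC: "X \<in> A" "Y \<in> C" using XY EAC by auto
    have "Y \<noteq> Y0"
    proof
      assume "Y = Y0"
      then have "card X = m" using XY(2) Y0 by simp
      then have "\<not> X \<subseteq> {}" "\<not> Y1 \<subseteq> Y0"
        using \<open>m \<ge> 1\<close> symmetric_chain_subset_iff[OF sC Y1(1) Y0(1)] Y0 Y1 n by auto
      then show False
        using product_symmetric_chain_comparable[OF psc[OF E(1)] E(2) XY(1)] \<open>Y = Y0\<close> by blast
    qed
    then have Y: "Y = Y1" "card X = m - 1" using YC[OF XYAC(2)] XY(2) by auto
    \<comment> \<open>\<open>D\<close> also has a pair of rank \<open>m + j\<close>; disjointness
      from \<open>E\<close> leaves only \<open>({1..m}, Y0)\<close> for it.\<close>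
    have "\<exists>X' Y'. (X', Y') \<in> D \<and> card X' + card Y' = m + j"
      by (rule product_symmetric_chain_level[OF psc[OF D(1)] D(2)]) (use Y0 n \<open>m \<ge> 1\<close> in auto)
    then obtain X' Y' where XY': "(X', Y') \<in> D" "card X' + card Y' = m + j" by blast
    have XYAC': "X' \<in> A" "Y' \<in> C" using XY' DAC by auto
    have "Y' \<noteq> Y1"
    proof
      assume "Y' = Y1"
      then have "card X' = card X" using XY'(2) Y Y1 n by simp
      then have "X' = X" by (rule symmetric_chain_card_inj[OF sA XYAC'(1) XYAC(1)])
      then show False using disj[OF XY(1)] XY'(1) Y \<open>Y' = Y1\<close> by simp
    qed
    then have "Y' = Y0" "card X' = m" using YC[OF XYAC'(2)] XY'(2) by auto
    then have "({1..m}, Y0) \<in> D"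
      using XY'(1) card_eq_cube[OF symmetric_chain_cube[OF sA XYAC'(1)]] by simp
    then show ?thesis using D Y0(1) by blast
  qed
qed

text \<open>The selector takes a traversed element from each short chain. If two decompositions took
  the same set, two of their chains would share two pairs with equal second component, whereas the
  only two pairs permitted have second components \<open>{}\<close> and
  \<open>{1..n}\<close>.\<close>

lemma good_if_product_decompositions:
  assumes K: "product_decompositions m n k F G K"
    and F: "almost_orthogonal_scds m k F" and G: "almost_orthogonal_scds n k G"
    and "m \<ge> 1" and "n \<ge> 2"
  shows "good n k G"
proof -
  have sF: "scd m (F i)" and sG: "scd n (G i)" if "i \<in> {1..k}" for i
    using F G that by (auto simp: almost_orthogonal_scds_def)
  define g where "g = (\<lambda>i C. SOME Y. Y \<in> C \<and> (\<exists>D\<in>K i. ({}, Y) \<in> D \<and> ({1..m}, Y) \<in> D))"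
  have g: "g i C \<in> C \<and> (\<exists>D\<in>K i. ({}, g i C) \<in> D \<and> ({1..m}, g i C) \<in> D)"
    if "i \<in> {1..k}" "C \<in> G i" "card C \<le> 2" for i C
  proof -
    have "\<exists>Y. Y \<in> C \<and> (\<exists>D\<in>K i. ({}, Y) \<in> D \<and> ({1..m}, Y) \<in> D)"
      using short_chain_traversed[OF K that(1) sF[OF that(1)] sG[OF that(1)] \<open>m \<ge> 1\<close> that(2,3)]
      by blast
    then show ?thesis unfolding g_def by (rule someI_ex)
  qed
  have "short_chain_selector k G g"
    unfolding short_chain_selector_def
  proof (intro conjI ballI impI)
    show "g i C \<in> C" if "i \<in> {1..k}" "C \<in> G i" "card C \<le> 2" for i C
      using g[OF that] by blast
    fix i j C C' assume ij: "i \<in> {1..k}" "j \<in> {1..k}" "C \<in> G i" "C' \<in> G j"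
      "card C \<le> 2" "card C' \<le> 2" "i \<noteq> j"
    show "g i C \<noteq> g j C'"
    proof
      assume eq: "g i C = g j C'"
      obtain D where D: "D \<in> K i" "({}, g i C) \<in> D" "({1..m}, g i C) \<in> D"
        using g[OF ij(1,3,5)] by blast
      obtain E where E: "E \<in> K j" "({}, g i C) \<in> E" "({1..m}, g i C) \<in> E"
        using g[OF ij(2,4,6)] eq by auto
      have "{({}, g i C), ({1..m}, g i C)} = {({}, {}), ({1..m}, {1..n})}"
        using D E \<open>m \<ge> 1\<close>
        by (intro K[unfolded product_decompositions_def, THEN conjunct2, rule_format,
              OF ij(1,2,7) D(1) E(1)]) auto
      then have "g i C = {}" "g i C = {1..n}" using \<open>m \<ge> 1\<close> by (auto simp: doubleton_eq_iff)
      then show False using \<open>n \<ge> 2\<close> by simp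
    qed
  qed
  then show ?thesis using good_iff_selector[OF G \<open>n \<ge> 2\<close>] by blast
qed

section \<open>Decompositions of a single rectangle\<close>

text \<open>
  The fibres of a grid labelling decompose \<open>{0..a} \<times> {0..c}\<close> into symmetric chains.
\<close>

definition grid_labelling :: "nat \<Rightarrow> nat \<Rightarrow> (nat \<Rightarrow> nat \<Rightarrow> nat) \<Rightarrow> bool" where
  "grid_labelling a c f \<longleftrightarrow>
     (\<forall>x\<le>a. \<forall>y\<le>c. \<forall>x'\<le>a. \<forall>y'\<le>c. f x y = f x' y' \<longrightarrow> x \<le> x' \<and> y \<le> y' \<or> x' \<le> x \<and> y' \<le> y) \<and>
     (\<forall>x\<le>a. \<forall>y\<le>c. \<exists>j. 2 * j \<le> a + c \<and>
        {u + v | u v. u \<le> a \<and> v \<le> c \<and> f u v = f x y} = {j..a + c - j})"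

lemma grid_labelling_transpose:
  assumes "grid_labelling a c f"
  shows "grid_labelling c a (\<lambda>x y. f y x)"
proof -
  have "{u + v | u v. u \<le> c \<and> v \<le> a \<and> f v u = l} = {u + v | u v. u \<le> a \<and> v \<le> c \<and> f u v = l}" for l
    by (auto; metis add.commute)
  then show ?thesis
    unfolding grid_labelling_def
    using assms[unfolded grid_labelling_def, THEN conjunct1, rule_format]
      assms[unfolded grid_labelling_def, THEN conjunct2, rule_format]
    by (simp add: add.commute) blast
qed

text \<open>The fibre of label \<open>l\<close> is an L-shaped path: upwards from
  \<open>(l, 0)\<close> to \<open>(l, c - l)\<close>, then to the right as far as
  \<open>(a, c - l)\<close>. Its coordinate sums run from \<open>l\<close> to
  \<open>a + c - l\<close> without gaps.\<close>

lemma grid_labelling_min: "grid_labelling a c (\<lambda>x y. min x (c - y))"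
  unfolding grid_labelling_def
proof (intro conjI allI impI)
  show "x \<le> x' \<and> y \<le> y' \<or> x' \<le> x \<and> y' \<le> y"
    if "x \<le> a" "y \<le> c" "x' \<le> a" "y' \<le> c" "min x (c - y) = min x' (c - y')" for x y x' y'
    using that by (auto simp: min_def split: if_splits)
  fix x y assume xy: "x \<le> a" "y \<le> c"
  define l where "l = min x (c - y)"
  have l: "l \<le> a" "l \<le> c" using xy by (auto simp: l_def)
  have "{u + v | u v. u \<le> a \<and> v \<le> c \<and> min u (c - v) = l} = {l..a + c - l}"
  proof (intro subset_antisym subsetI)
    show "r \<in> {l..a + c - l}" if "r \<in> {u + v | u v. u \<le> a \<and> v \<le> c \<and> min u (c - v) = l}" for r
      using that by (auto simp: min_def split: if_splits)
    fix r assume r: "r \<in> {l..a + c - l}"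
    show "r \<in> {u + v | u v. u \<le> a \<and> v \<le> c \<and> min u (c - v) = l}"
    \<comment> \<open>The sum at the turning point of the path is \<open>c\<close>: smaller sums lie
      on the vertical arm, larger ones on the horizontal arm.\<close>
    proof (cases "r \<le> c")
      case True
      then show ?thesis using r l by (intro CollectI exI[of _ l] exI[of _ "r - l"]) auto
    next
      case False
      then show ?thesis using r l by (intro CollectI exI[of _ "r - (c - l)"] exI[of _ "c - l"]) auto
    qed
  qed
  then show "\<exists>j. 2 * j \<le> a + c \<and> {u + v | u v. u \<le> a \<and> v \<le> c \<and> min u (c - v) = min x (c - y)}
      = {j..a + c - j}"
    using l unfolding l_def[symmetric] by (intro exI[of _ l]) auto
qed

text \<open>
  The chain of the previous labelling through \<open>(0, 0)\<close> and \<open>(a, c)\<close> also passes through the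
  corner \<open>(0, c)\<close>; exchanging its two end points with the next chain separates them.
\<close>

lemma grid_labelling_exchange:
  assumes "a \<ge> 2" "c \<ge> 2"
  shows "grid_labelling a c (\<lambda>x y. if x = 0 \<and> y = 0 \<or> x = a \<and> y = c then 1 else min x (c - y))"
    (is "grid_labelling a c ?f")
  unfolding grid_labelling_def
proof (intro conjI allI impI)
  show "x \<le> x' \<and> y \<le> y' \<or> x' \<le> x \<and> y' \<le> y"
    if "x \<le> a" "y \<le> c" "x' \<le> a" "y' \<le> c" "?f x y = ?f x' y'" for x y x' y'
    using that by (auto simp: min_def split: if_splits)
  fix x y assume xy: "x \<le> a" "y \<le> c"
  define l where "l = ?f x y"
  have l: "l \<le> a" "l \<le> c" using xy assms by (auto simp: l_def)
  \<comment> \<open>\<open>j\<close> is the smallest sum on the fibre. Label 1 has gained the two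
    end points and starts at 0, label 0 has lost them and starts at 1, and the other labels are as
    before.\<close>
  define j where "j = (if l = 1 then 0 else if l = 0 then 1 else l)"
  have j: "2 * j \<le> a + c" using l assms by (auto simp: j_def)
  have "{u + v | u v. u \<le> a \<and> v \<le> c \<and> ?f u v = l} = {j..a + c - j}"
  proof (intro subset_antisym subsetI)
    show "r \<in> {j..a + c - j}" if R: "r \<in> {u + v | u v. u \<le> a \<and> v \<le> c \<and> ?f u v = l}" for r
    proof -
      obtain u v where "r = u + v" "u \<le> a" "v \<le> c" "?f u v = l" using R by blast
      then show ?thesis by (cases "l = 0"; cases "l = 1") (auto simp: j_def min_def split: if_splits)
    qed
    fix r assume r: "r \<in> {j..a + c - j}"
    have "\<exists>u v. r = u + v \<and> u \<le> a \<and> v \<le> c \<and> ?f u v = l"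
    proof -
      \<comment> \<open>Apart from the two exchanged end points, the witnesses are the points of the
        L-shaped paths, on the vertical arm for \<open>r \<le> c\<close> and on the horizontal arm
        otherwise.\<close>
      consider "l = 1" "r = 0" | "l = 1" "r = a + c" | "l \<noteq> 1 \<or> 0 < r \<and> r < a + c" "r \<le> c"
        | "l \<noteq> 1 \<or> 0 < r \<and> r < a + c" "r > c"
        using r by force
      then show ?thesis
      proof cases
        case 1
        then show ?thesis by (intro exI[of _ 0]) auto
      next
        case 2
        then show ?thesis by (intro exI[of _ a] exI[of _ c]) auto
      next
        case 3
        then show ?thesis using r l assms
          by (intro exI[of _ l] exI[of _ "r - l"]) (auto simp: j_def split: if_splits)
      next
        case 4
        then show ?thesis using r l assms
          by (intro exI[of _ "r - (c - l)"] exI[of _ "c - l"]) (auto simp: j_def split: if_splits)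
      qed
    qed
    then show "r \<in> {u + v | u v. u \<le> a \<and> v \<le> c \<and> ?f u v = l}" by blast
  qed
  then show "\<exists>j. 2 * j \<le> a + c \<and> {u + v | u v. u \<le> a \<and> v \<le> c \<and> ?f u v = ?f x y} = {j..a + c - j}"
    using j unfolding l_def[symmetric] by blast
qed

text \<open>Equality of \<open>f 0 y\<close> and \<open>f a y\<close> means that one chain joins
  both ends of the row \<open>y\<close>. Across a long side, \<open>min x (c - y)\<close> does this
  only in the row \<open>y = c\<close> or the column \<open>x = 0\<close>, its transpose only in
  \<open>y = 0\<close> or \<open>x = a\<close>; together they serve every choice on a short side. If
  both sides are long, the exchanged labelling avoids it altogether.\<close>

lemma grid_labelling_exists:
  assumes "c \<le> 1 \<Longrightarrow> g \<le> c" "a \<le> 1 \<Longrightarrow> h \<le> a"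
  shows "\<exists>f. grid_labelling a c f \<and>
    (2 \<le> a \<longrightarrow> (\<forall>y\<le>c. f 0 y = f a y \<longrightarrow> c \<le> 1 \<and> y = g)) \<and>
    (2 \<le> c \<longrightarrow> (\<forall>x\<le>a. f x 0 = f x c \<longrightarrow> a \<le> 1 \<and> x = h))"
proof -
  have transposed: "grid_labelling a c (\<lambda>x y. min y (a - x))"
    using grid_labelling_transpose[OF grid_labelling_min] .
  consider "2 \<le> a" "2 \<le> c" | "2 \<le> a" "c \<le> 1" "g = c" | "2 \<le> a" "c = 1" "g = 0"
    | "a \<le> 1" "2 \<le> c" "h = 0" | "a = 1" "2 \<le> c" "h = 1" | "a \<le> 1" "c \<le> 1"
    using assms by linarith
  then show ?thesis
  proof cases
    case 1
    show ?thesis by (intro exI conjI, rule grid_labelling_exchange) (use 1 in auto)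
  next
    case 2
    show ?thesis by (intro exI conjI, rule grid_labelling_min) (use 2 in auto)
  next
    case 3
    show ?thesis by (intro exI conjI, rule transposed) (use 3 in auto)
  next
    case 4
    show ?thesis by (intro exI conjI, rule grid_labelling_min) (use 4 in auto)
  next
    case 5
    show ?thesis by (intro exI conjI, rule transposed) (use 5 in auto)
  next
    case 6
    show ?thesis by (intro exI conjI, rule grid_labelling_min) (use 6 in auto)
  qed
qed

text \<open>Sizes relative to the bottoms of \<open>A\<close> and \<open>C\<close> turn the
  rectangle into a grid, and the chains are the fibres of a labelling of it. Pairs
  \<open>({}, Y)\<close> and \<open>({1..m}, Y)\<close> exist only if \<open>A\<close> is full; its
  side then has length \<open>m \<ge> 2\<close>, so the condition on rows applies.\<close>

lemma rectangle_decomposition: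
  assumes A: "symmetric_chain m A" and C: "symmetric_chain n C" and "m \<ge> 2" "n \<ge> 2"
    and X0: "card A \<le> 2 \<Longrightarrow> X0 \<in> A" and Y0: "card C \<le> 2 \<Longrightarrow> Y0 \<in> C"
  shows "\<exists>P. partition_on (A \<times> C) P \<and> (\<forall>D\<in>P. product_symmetric_chain m n D \<and>
    (\<forall>Y. ({}, Y) \<in> D \<longrightarrow> ({1..m}, Y) \<in> D \<longrightarrow> card C \<le> 2 \<and> Y = Y0) \<and>
    (\<forall>X. (X, {}) \<in> D \<longrightarrow> (X, {1..n}) \<in> D \<longrightarrow> card A \<le> 2 \<and> X = X0))"
proof -
  obtain p where p: "2 * p \<le> m" "card ` A = {p..m - p}" "card A = m - 2 * p + 1"
    using symmetric_chainE[OF A] .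
  obtain q where q: "2 * q \<le> n" "card ` C = {q..n - q}" "card C = n - 2 * q + 1"
    using symmetric_chainE[OF C] .
  define a c where "a = m - 2 * p" and "c = n - 2 * q"
  have m: "m = a + 2 * p" and n: "n = c + 2 * q" using p q by (auto simp: a_def c_def)
  have cardA: "card A = a + 1" and cardC: "card C = c + 1" using p q by (auto simp: a_def c_def)
  have levA: "\<exists>x\<le>a. card X = p + x" if "X \<in> A" for X
  proof -
    have "card X \<in> {p..m - p}" using that p(2) by blast
    then show ?thesis using m by (intro exI[of _ "card X - p"]) auto
  qed
  have levC: "\<exists>y\<le>c. card Y = q + y" if "Y \<in> C" for Y
  proof -
    have "card Y \<in> {q..n - q}" using that q(2) by blast
    then show ?thesis using n by (intro exI[of _ "card Y - q"]) auto
  qed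
  have exA: "\<exists>X\<in>A. card X = p + x" if "x \<le> a" for x
  proof -
    have "p + x \<in> card ` A" using that m p(2) by auto
    then show ?thesis by force
  qed
  have exC: "\<exists>Y\<in>C. card Y = q + y" if "y \<le> c" for y
  proof -
    have "q + y \<in> card ` C" using that n q(2) by auto
    then show ?thesis by force
  qed
  \<comment> \<open>The row and column prescribed for the grid are the levels of the chosen elements
    above the bottoms of their chains.\<close>
  have "card Y0 - q \<le> c" if "c \<le> 1" using levC[of Y0] Y0 that cardC by auto
  moreover have "card X0 - p \<le> a" if "a \<le> 1" using levA[of X0] X0 that cardA by auto
  ultimately obtain f where f: "grid_labelling a c f"
    and f1: "\<And>y. 2 \<le> a \<Longrightarrow> y \<le> c \<Longrightarrow> f 0 y = f a y \<Longrightarrow> c \<le> 1 \<and> y = card Y0 - q"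
    and f2: "\<And>x. 2 \<le> c \<Longrightarrow> x \<le> a \<Longrightarrow> f x 0 = f x c \<Longrightarrow> a \<le> 1 \<and> x = card X0 - p"
    using grid_labelling_exists[of c "card Y0 - q" a "card X0 - p"] by blast
  define lab :: "nat set \<times> nat set \<Rightarrow> nat" where "lab = (\<lambda>P. f (card (fst P) - p) (card (snd P) - q))"
  define fib where "fib = (\<lambda>l. {P \<in> A \<times> C. lab P = l})"
  have "partition_on (A \<times> C) (fib ` lab ` (A \<times> C))"
    by (rule partition_onI) (auto simp: fib_def disjnt_def)
  moreover have "product_symmetric_chain m n (fib (lab R))" if R: "R \<in> A \<times> C" for R
    unfolding product_symmetric_chain_def
  proof (intro conjI ballI)
    show "fib (lab R) \<subseteq> cube m \<times> cube n"
      using symmetric_chain_cube[OF A] symmetric_chain_cube[OF C] by (auto simp: fib_def)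
    fix P Q assume "P \<in> fib (lab R)" "Q \<in> fib (lab R)"
    then have PQ: "P \<in> A \<times> C" "Q \<in> A \<times> C" "lab P = lab Q" by (auto simp: fib_def)
    obtain X Y X' Y' where XY: "P = (X, Y)" "Q = (X', Y')" by force
    then have mem: "X \<in> A" "Y \<in> C" "X' \<in> A" "Y' \<in> C" using PQ by auto
    obtain x x' where x: "x \<le> a" "card X = p + x" "x' \<le> a" "card X' = p + x'"
      using levA mem by blast
    obtain y y' where y: "y \<le> c" "card Y = q + y" "y' \<le> c" "card Y' = q + y'"
      using levC mem by blast
    have "f x y = f x' y'" using PQ(3) XY x y by (simp add: lab_def)
    then have "x \<le> x' \<and> y \<le> y' \<or> x' \<le> x \<and> y' \<le> y"
      using f x(1,3) y(1,3) unfolding grid_labelling_def by blast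
    then show "fst P \<subseteq> fst Q \<and> snd P \<subseteq> snd Q \<or> fst Q \<subseteq> fst P \<and> snd Q \<subseteq> snd P"
      using XY x y symmetric_chain_subset_iff[OF A mem(1,3)] symmetric_chain_subset_iff[OF A mem(3,1)]
        symmetric_chain_subset_iff[OF C mem(2,4)] symmetric_chain_subset_iff[OF C mem(4,2)]
      by simp
  next
    obtain x where x: "x \<le> a" "card (fst R) = p + x" using levA R by (metis mem_Times_iff)
    obtain y where y: "y \<le> c" "card (snd R) = q + y" using levC R by (metis mem_Times_iff)
    have labR: "lab R = f x y" using x y by (simp add: lab_def)
    obtain j where j: "2 * j \<le> a + c"
      "{u + v | u v. u \<le> a \<and> v \<le> c \<and> f u v = f x y} = {j..a + c - j}"
      using f x(1) y(1) unfolding grid_labelling_def by blast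
    \<comment> \<open>Ranks are grid sums shifted by \<open>p + q\<close>, and
      \<open>m + n = a + c + 2 * (p + q)\<close> keeps the interval symmetric.\<close>
    have "(\<lambda>P. card (fst P) + card (snd P)) ` fib (lab R) = {p + q + j..m + n - (p + q + j)}"
    proof (intro subset_antisym subsetI)
      fix r assume "r \<in> (\<lambda>P. card (fst P) + card (snd P)) ` fib (lab R)"
      then obtain X Y where XY: "X \<in> A" "Y \<in> C" "lab (X, Y) = lab R" "r = card X + card Y"
        by (auto simp: fib_def)
      obtain u v where uv: "u \<le> a" "card X = p + u" "v \<le> c" "card Y = q + v"
        using levA levC XY by blast
      then have "f u v = f x y" using XY labR by (simp add: lab_def)
      then have "u + v \<in> {j..a + c - j}" using j(2) uv by blast
      then show "r \<in> {p + q + j..m + n - (p + q + j)}" using XY uv m n j(1) by auto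
    next
      fix r assume "r \<in> {p + q + j..m + n - (p + q + j)}"
      then have "r - (p + q) \<in> {j..a + c - j}" and rpq: "r \<ge> p + q" using m n j(1) by auto
      then obtain u v where uv: "r - (p + q) = u + v" "u \<le> a" "v \<le> c" "f u v = f x y"
        using j(2) by blast
      obtain X Y where XY: "X \<in> A" "card X = p + u" "Y \<in> C" "card Y = q + v"
        using exA exC uv by blast
      then have "(X, Y) \<in> fib (lab R)" using labR uv by (simp add: fib_def lab_def)
      moreover have "r = card X + card Y" using XY uv rpq by simp
      ultimately show "r \<in> (\<lambda>P. card (fst P) + card (snd P)) ` fib (lab R)" by force
    qed
    then show "\<exists>j. 2 * j \<le> m + n \<and>
        (\<lambda>P. card (fst P) + card (snd P)) ` fib (lab R) = {j..m + n - j}"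
      using j(1) m n by (intro exI[of _ "p + q + j"]) auto
  qed
  moreover have "card C \<le> 2 \<and> Y = Y0" if h: "({}, Y) \<in> fib l" "({1..m}, Y) \<in> fib l" for Y l
  proof -
    have "{} \<in> A" "Y \<in> C" using h by (auto simp: fib_def)
    \<comment> \<open>Containing \<open>{}\<close>, the chain \<open>A\<close> has
      \<open>m + 1\<close> elements, so the grid columns 0 and \<open>a\<close> belong to
      \<open>{}\<close> and \<open>{1..m}\<close>.\<close>
    then have "a = m" "p = 0" using symmetric_chain_bot_or_top(3)[OF A] cardA m by auto
    obtain y where y: "y \<le> c" "card Y = q + y" using levC \<open>Y \<in> C\<close> by blast
    have "f 0 y = f a y" using h y \<open>a = m\<close> \<open>p = 0\<close> by (auto simp: fib_def lab_def)
    then have cy: "c \<le> 1" "y = card Y0 - q" using f1 y(1) \<open>m \<ge> 2\<close> \<open>a = m\<close> by auto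
    then have "Y0 \<in> C" "card C \<le> 2" using Y0 cardC by auto
    then have "card Y = card Y0" using levC[of Y0] cy y by auto
    then show ?thesis
      using symmetric_chain_card_inj[OF C \<open>Y \<in> C\<close> \<open>Y0 \<in> C\<close>] \<open>card C \<le> 2\<close> by blast
  qed
  moreover have "card A \<le> 2 \<and> X = X0" if h: "(X, {}) \<in> fib l" "(X, {1..n}) \<in> fib l" for X l
  proof -
    have "{} \<in> C" "X \<in> A" using h by (auto simp: fib_def)
    then have "c = n" "q = 0" using symmetric_chain_bot_or_top(3)[OF C] cardC n by auto
    obtain x where x: "x \<le> a" "card X = p + x" using levA \<open>X \<in> A\<close> by blast
    have "f x 0 = f x c" using h x \<open>c = n\<close> \<open>q = 0\<close> by (auto simp: fib_def lab_def)
    then have cx: "a \<le> 1" "x = card X0 - p" using f2 x(1) \<open>n \<ge> 2\<close> \<open>c = n\<close> by auto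
    then have "X0 \<in> A" "card A \<le> 2" using X0 cardA by auto
    then have "card X = card X0" using levA[of X0] cx x by auto
    then show ?thesis
      using symmetric_chain_card_inj[OF A \<open>X \<in> A\<close> \<open>X0 \<in> A\<close>] \<open>card A \<le> 2\<close> by blast
  qed
  ultimately show ?thesis by (intro exI[of _ "fib ` lab ` (A \<times> C)"]) blast
qed

section \<open>Sufficiency of goodness and the equivalence\<close>

lemma partition_on_Times_refine:
  assumes "partition_on S F" "partition_on T G"
    and P: "\<And>A C. A \<in> F \<Longrightarrow> C \<in> G \<Longrightarrow> partition_on (A \<times> C) (P A C)"
  shows "partition_on (S \<times> T) (\<Union>A\<in>F. \<Union>C\<in>G. P A C)"
proof (rule partition_onI)
  have "\<Union>(\<Union>A\<in>F. \<Union>C\<in>G. P A C) = (\<Union>A\<in>F. \<Union>C\<in>G. \<Union>(P A C))" by blast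
  also have "\<dots> = (\<Union>A\<in>F. \<Union>C\<in>G. A \<times> C)"
    by (intro SUP_cong refl) (simp add: partition_onD1[OF P, symmetric])
  also have "\<dots> = S \<times> T"
    using partition_onD1[OF assms(1)] partition_onD1[OF assms(2)] by blast
  finally show "\<Union>(\<Union>A\<in>F. \<Union>C\<in>G. P A C) = S \<times> T" .
  show "{} \<notin> (\<Union>A\<in>F. \<Union>C\<in>G. P A C)" using partition_onD3[OF P] by blast
  fix D E assume DE: "D \<in> (\<Union>A\<in>F. \<Union>C\<in>G. P A C)" "E \<in> (\<Union>A\<in>F. \<Union>C\<in>G. P A C)" "D \<noteq> E"
  then obtain A C A' C' where AC: "A \<in> F" "C \<in> G" "D \<in> P A C" "A' \<in> F" "C' \<in> G" "E \<in> P A' C'"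
    by blast
  show "disjnt D E"
  proof (cases "A = A' \<and> C = C'")
    case True
    then show ?thesis
      using partition_onD2[OF P[OF AC(1,2)]] AC DE(3) by (auto simp: disjoint_def disjnt_def)
  next
    case False
    then have "A \<inter> A' = {} \<or> C \<inter> C' = {}"
      using disjointD[OF partition_onD2[OF assms(1)] AC(1,4)]
        disjointD[OF partition_onD2[OF assms(2)] AC(2,5)] by blast
    moreover have "D \<subseteq> A \<times> C" "E \<subseteq> A' \<times> C'"
      using partition_onD1[OF P[OF AC(1,2)]] partition_onD1[OF P[OF AC(4,5)]] AC by auto
    ultimately show ?thesis unfolding disjnt_def by blast
  qed
qed

text \<open>Every rectangle is decomposed relative to selectors for the two families. If chains of
  different decompositions share two pairs, almost orthogonality of the factors makes each component
  either constant or the pair of bottom and top; the selectors exclude a constant component.\<close>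

lemma product_decompositions_if_good:
  assumes F: "almost_orthogonal_scds m k F" and G: "almost_orthogonal_scds n k G"
    and mn: "m \<ge> 2" "n \<ge> 2" and "good m k F" "good n k G"
  shows "\<exists>K. product_decompositions m n k F G K"
proof -
  obtain f g where f: "short_chain_selector k F f" and g: "short_chain_selector k G g"
    using assms good_iff_selector by blast
  have sF: "scd m (F i)" and sG: "scd n (G i)" if "i \<in> {1..k}" for i
    using F G that by (auto simp: almost_orthogonal_scds_def)
  have "\<exists>P. partition_on (A \<times> C) P \<and> (\<forall>D\<in>P. product_symmetric_chain m n D \<and>
      (\<forall>Y. ({}, Y) \<in> D \<longrightarrow> ({1..m}, Y) \<in> D \<longrightarrow> card C \<le> 2 \<and> Y = g i C) \<and>
      (\<forall>X. (X, {}) \<in> D \<longrightarrow> (X, {1..n}) \<in> D \<longrightarrow> card A \<le> 2 \<and> X = f i A))"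
    if "i \<in> {1..k}" "A \<in> F i" "C \<in> G i" for i A C
    using sF sG f g that mn
    by (intro rectangle_decomposition) (auto simp: scd_def short_chain_selector_def)
  then obtain P where
    part: "\<And>i A C. i \<in> {1..k} \<Longrightarrow> A \<in> F i \<Longrightarrow> C \<in> G i \<Longrightarrow> partition_on (A \<times> C) (P i A C)" and
    P: "\<And>i A C. i \<in> {1..k} \<Longrightarrow> A \<in> F i \<Longrightarrow> C \<in> G i \<Longrightarrow> \<forall>D\<in>P i A C. product_symmetric_chain m n D \<and>
      (\<forall>Y. ({}, Y) \<in> D \<longrightarrow> ({1..m}, Y) \<in> D \<longrightarrow> card C \<le> 2 \<and> Y = g i C) \<and>
      (\<forall>X. (X, {}) \<in> D \<longrightarrow> (X, {1..n}) \<in> D \<longrightarrow> card A \<le> 2 \<and> X = f i A)"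
    by metis
  have PY: "card C \<le> 2 \<and> Y = g i C"
    if "i \<in> {1..k}" "A \<in> F i" "C \<in> G i" "D \<in> P i A C" "({}, Y) \<in> D" "({1..m}, Y) \<in> D" for i A C D Y
    using P[OF that(1-3), THEN bspec, OF that(4)] that(5,6) by blast
  have PX: "card A \<le> 2 \<and> X = f i A"
    if "i \<in> {1..k}" "A \<in> F i" "C \<in> G i" "D \<in> P i A C" "(X, {}) \<in> D" "(X, {1..n}) \<in> D" for i A C D X
    using P[OF that(1-3), THEN bspec, OF that(4)] that(5,6) by blast
  define K where "K = (\<lambda>i. \<Union>A\<in>F i. \<Union>C\<in>G i. P i A C)"
  have "product_decompositions m n k F G K"
    unfolding product_decompositions_def
  proof (intro conjI ballI impI)
    fix i assume i: "i \<in> {1..k}"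
    show "partition_on (cube m \<times> cube n) (K i)"
      unfolding K_def using sF[OF i] sG[OF i] part[OF i]
      by (intro partition_on_Times_refine) (auto simp: scd_def)
    fix D assume "D \<in> K i"
    then obtain A C where AC: "A \<in> F i" "C \<in> G i" "D \<in> P i A C" by (auto simp: K_def)
    then show "product_symmetric_chain m n D" using P[OF i] by blast
    have "D \<subseteq> A \<times> C" using partition_onD1[OF part[OF i AC(1,2)]] AC(3) by blast
    then show "\<exists>A\<in>F i. \<exists>C\<in>G i. D \<subseteq> A \<times> C" using AC by blast
  next
    fix i j D E R S
    assume ij: "i \<in> {1..k}" "j \<in> {1..k}" "i \<noteq> j" and DE: "D \<in> K i" "E \<in> K j"
      and RS: "R \<in> D \<inter> E" "S \<in> D \<inter> E" "R \<noteq> S"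
    obtain A C where AC: "A \<in> F i" "C \<in> G i" "D \<in> P i A C" using DE by (auto simp: K_def)
    obtain A' C' where AC': "A' \<in> F j" "C' \<in> G j" "E \<in> P j A' C'" using DE by (auto simp: K_def)
    have sub: "D \<subseteq> A \<times> C" "E \<subseteq> A' \<times> C'"
      using partition_onD1[OF part[OF ij(1) AC(1,2)]] partition_onD1[OF part[OF ij(2) AC'(1,2)]]
        AC(3) AC'(3) by auto
    obtain X Y X' Y' where XY: "R = (X, Y)" "S = (X', Y')" by force
    have mem: "X \<in> A" "X \<in> A'" "X' \<in> A" "X' \<in> A'" "Y \<in> C" "Y \<in> C'" "Y' \<in> C" "Y' \<in> C'"
      using RS XY sub by auto
    have mn1: "1 \<le> m" "1 \<le> n" using mn by auto
    have X: "X \<noteq> X' \<Longrightarrow> {X, X'} = {{}, {1..m}}"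
      by (rule almost_orthogonal_scdsD[OF F mn1(1) ij AC(1) AC'(1) mem(1-4)])
    have Y: "Y \<noteq> Y' \<Longrightarrow> {Y, Y'} = {{}, {1..n}}"
      by (rule almost_orthogonal_scdsD[OF G mn1(2) ij AC(2) AC'(2) mem(5-8)])
    have "X \<noteq> X'"
    proof
      assume "X = X'"
      then have "{Y, Y'} = {{}, {1..n}}" using Y RS(3) XY by blast
      \<comment> \<open>With \<open>X\<close> constant, both chains contain \<open>X\<close> paired
        with \<open>{}\<close> and with \<open>{1..n}\<close>, so \<open>X\<close> is selected from
        \<open>A\<close> and from \<open>A'\<close>, against the selector property.\<close>
      then have "(X, {}) \<in> D" "(X, {1..n}) \<in> D" "(X, {}) \<in> E" "(X, {1..n}) \<in> E"
        using RS XY \<open>X = X'\<close> by (auto simp: doubleton_eq_iff)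
      then have "card A \<le> 2 \<and> X = f i A" "card A' \<le> 2 \<and> X = f j A'"
        using PX[OF ij(1) AC] PX[OF ij(2) AC'] by blast+
      then show False using f ij AC(1) AC'(1) unfolding short_chain_selector_def by metis
    qed
    moreover have "Y \<noteq> Y'"
    proof
      assume "Y = Y'"
      then have "{X, X'} = {{}, {1..m}}" using X RS(3) XY by blast
      then have "({}, Y) \<in> D" "({1..m}, Y) \<in> D" "({}, Y) \<in> E" "({1..m}, Y) \<in> E"
        using RS XY \<open>Y = Y'\<close> by (auto simp: doubleton_eq_iff)
      then have "card C \<le> 2 \<and> Y = g i C" "card C' \<le> 2 \<and> Y = g j C'"
        using PY[OF ij(1) AC] PY[OF ij(2) AC'] by blast+
      then show False using g ij AC(2) AC'(2) unfolding short_chain_selector_def by metis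
    qed
    \<comment> \<open>Comparability rules out the crossed combination of \<open>({}, {1..n})\<close>
      with \<open>({1..m}, {})\<close>.\<close>
    moreover have "X \<subseteq> X' \<and> Y \<subseteq> Y' \<or> X' \<subseteq> X \<and> Y' \<subseteq> Y"
    proof -
      have "product_symmetric_chain m n D" using P[OF ij(1) AC(1,2)] AC(3) by blast
      then show ?thesis
        by (rule product_symmetric_chain_comparable) (use RS XY in auto)
    qed
    ultimately show "{R, S} = {({}, {}), ({1..m}, {1..n})}"
      using X Y XY by (auto simp: doubleton_eq_iff)
  qed
  then show ?thesis by blast
qed

theorem theorem5p6:
  fixes m n k :: nat and F G :: "nat \<Rightarrow> nat set set set"
  assumes "m \<ge> 2" and "n \<ge> 2" and "k \<ge> 1"
    and "almost_orthogonal_scds m k F"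
    and "almost_orthogonal_scds n k G"
  shows "(\<exists>H :: nat \<Rightarrow> nat set set set. almost_orthogonal_scds (m + n) k H \<and>
            (\<forall>i\<in>{1..k}. \<forall>D\<in>H i. \<exists>A\<in>F i. \<exists>C\<in>G i. D \<subseteq> rectangle m A C))
         \<longleftrightarrow> good m k F \<and> good n k G"
proof -
  have F: "scd m (F i)" and G: "scd n (G i)" if "i \<in> {1..k}" for i
    using assms(4,5) that by (auto simp: almost_orthogonal_scds_def)
  have "m + n \<ge> 1" using assms(1) by simp
  note decompositions_iff_product_decompositions[OF this F G]
  also have "(\<exists>K. product_decompositions m n k F G K) \<longleftrightarrow> good m k F \<and> good n k G"
  proof
    assume "\<exists>K. product_decompositions m n k F G K"
    then obtain K where K: "product_decompositions m n k F G K" by blast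
    have "good n k G"
      by (rule good_if_product_decompositions[OF K assms(4,5)]) (use assms in auto)
    \<comment> \<open>After exchanging the factors, the first family takes the place of the
      second.\<close>
    moreover have "good m k F"
      by (rule good_if_product_decompositions[OF product_decompositions_swap[OF K] assms(5,4)])
        (use assms in auto)
    ultimately show "good m k F \<and> good n k G" by blast
  next
    assume "good m k F \<and> good n k G"
    then show "\<exists>K. product_decompositions m n k F G K"
      using product_decompositions_if_good[OF assms(4,5,1,2)] by blast
  qed
  finally show ?thesis .
qed

end
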